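(* Let $F:\mathcal S\to\mathbb R$ satisfy hypotheses (i) and (ii) of the context, let $D\subset\mathbb R^n$ be a domain, and let $u$ be a maximal viscosity solution of $F(D^2u)=-\chi_{\{u>0\}}$ in $D$. Then there is a universal constant $c_{n,\gamma}>0$, depending only on the dimension $n$ and on $\gamma=\frac{\Lambda(n-1)}{\lambda}-1$, such that for every ball $B_r(x_0)\subset D$, $$\inf_{B_r(x_0)}u>-c_{n,\gamma}\,r^2\quad\text{implies}\quad u(x_0)>0.$$
   Context: $\mathcal S$ is the space of real symmetric $n\times n$ matrices. Hypotheses on $F:\mathcal S\to\mathbb R$: (i) (uniform ellipticity) there are constants $\lambda,\Lambda>0$ such that $\lambda\|N\|\le F(M+N)-F(M)\le\Lambda\|N\|$ for all $M\in\mathcal S$ and all nonnegative $N\in\mathcal S$, where $\|\cdot\|$ is the matrix norm; (ii) $F$ is smooth except at the origin, homogeneous of degree one, $F(tM)=tF(M)$ for $t\in\mathbb R$, and $F(0)=0$. $\chi_{\{u>0\}}$ is the characteristic function of $\{u>0\}$. A continuous function $u$ is a viscosity solution of $F(D^2u)=-\chi_{\{u>0\}}$ in $D$ if, for every $x_0\in D$ and every paraboloid (quadratic polynomial) $v$: if $v$ touches the graph of $u$ from above at $(x_0,u(x_0))$, then $F(D^2v(x_0))\ge-\chi_{\{u>0\}}(x_0)$; and if $v$ touches the graph of $u$ from below at $(x_0,u(x_0))$, then $F(D^2v(x_0))\le-\chi_{\{u>0\}}(x_0)$. A viscosity solution $u$ of $F(D^2u)=-\chi_{\{u>0\}}$ is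 maximal in $D$ if for every subdomain $D'\subset D$ and every strong subsolution $v$ in $D'$ with $v\le u$ on $\partial D'$ one has $v\le u$ in $D'$. Here a strong subsolution in $D'$ is a function $v\in W^{2,n}_{loc}(D')\cap C(\overline{D'})$ with $F(D^2v)\ge-\chi_{\{v>0\}}$ a.e. in $D'$. $B_r(x_0)$ is the open ball of radius $r$ centered at $x_0$.
   Formalization: The bound −c_{n,γ} r² is replaced by −(c_{n,γ}/Λ) r²: without normalizing Λ the claim is false by scaling (F = K·trace with K large, u a small negative constant); for Λ ≤ 1 the stated bound follows. *)

theory Defs
  imports "HOL-Analysis.Analysis"
begin

section \<open>Smoothness relative to a linear subspace\<close>

text \<open>\<open>Ck_on k V A f\<close>: \<open>f\<close> is of class \<open>C\<^sup>k\<close> on \<open>A\<close>, a relatively open subset of the linear subspace \<open>V\<close>.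
  On \<open>V\<close> the derivative within \<open>A\<close> is unique, and only its values on \<open>V\<close> are used.\<close>

primrec Ck_on :: "nat \<Rightarrow> 'a::real_normed_vector set \<Rightarrow> 'a set \<Rightarrow> ('a \<Rightarrow> real) \<Rightarrow> bool" where
  "Ck_on 0 V A f \<longleftrightarrow> continuous_on A f"
| "Ck_on (Suc k) V A f \<longleftrightarrow>
     (\<exists>f'. (\<forall>x\<in>A. (f has_derivative f' x) (at x within A)) \<and>
           (\<forall>v\<in>V. Ck_on k V A (\<lambda>x. f' x v)))"

definition smooth_on_subspace :: "'a::real_normed_vector set \<Rightarrow> 'a set \<Rightarrow> ('a \<Rightarrow> real) \<Rightarrow> bool" where
  "smooth_on_subspace V A f \<longleftrightarrow> (\<forall>k. Ck_on k V A f)"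

section \<open>The operator\<close>

definition sym_mats :: "(real^'n^'n) set" where
  "sym_mats = {M. transpose M = M}"

definition nonneg_mat :: "real^'n^'n \<Rightarrow> bool" where
  "nonneg_mat N \<longleftrightarrow> (\<forall>x. 0 \<le> x \<bullet> (N *v x))"

text \<open>The library norm on \<open>real^'n^'n\<close> is the Frobenius norm; the matrix norm is the operator norm
  with respect to the Euclidean norm.\<close>

definition mat_norm :: "real^'n^'n \<Rightarrow> real" where
  "mat_norm M = onorm ((*v) M)"

text \<open>An operator on symmetric matrices is a function on all matrices of which only the values on
  \<^const>\<open>sym_mats\<close> are constrained.\<close>

definition uniformly_elliptic :: "real \<Rightarrow> real \<Rightarrow> (real^'n^'n \<Rightarrow> real) \<Rightarrow> bool" where
  "uniformly_elliptic l L F \<longleftrightarrow> l > 0 \<and> L > 0 \<and>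
     (\<forall>M\<in>sym_mats. \<forall>N\<in>sym_mats. nonneg_mat N \<longrightarrow>
        l * mat_norm N \<le> F (M + N) - F M \<and> F (M + N) - F M \<le> L * mat_norm N)"

definition smooth_homogeneous :: "(real^'n^'n \<Rightarrow> real) \<Rightarrow> bool" where
  "smooth_homogeneous F \<longleftrightarrow>
     smooth_on_subspace sym_mats (sym_mats - {0}) F \<and>
     (\<forall>t. \<forall>M\<in>sym_mats. F (t *\<^sub>R M) = t * F M) \<and> F 0 = 0"

section \<open>Viscosity solutions\<close>

definition domain :: "(real^'n) set \<Rightarrow> bool" where
  "domain D \<longleftrightarrow> open D \<and> connected D \<and> D \<noteq> {}"

definition pos_ind :: "(real^'n \<Rightarrow> real) \<Rightarrow> real^'n \<Rightarrow> real" where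
  "pos_ind u = indicator {y. u y > 0}"

text \<open>For symmetric \<open>M\<close> this is the general quadratic polynomial with Hessian \<open>M\<close>.\<close>

definition paraboloid :: "real \<Rightarrow> real^'n \<Rightarrow> real^'n^'n \<Rightarrow> real^'n \<Rightarrow> real" where
  "paraboloid a b M x = a + b \<bullet> x + (x \<bullet> (M *v x)) / 2"

definition touches_above :: "(real^'n \<Rightarrow> real) \<Rightarrow> (real^'n \<Rightarrow> real) \<Rightarrow> real^'n \<Rightarrow> bool" where
  "touches_above v u x0 \<longleftrightarrow> v x0 = u x0 \<and> (\<forall>\<^sub>F x in nhds x0. u x \<le> v x)"

definition touches_below :: "(real^'n \<Rightarrow> real) \<Rightarrow> (real^'n \<Rightarrow> real) \<Rightarrow> real^'n \<Rightarrow> bool" where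
  "touches_below v u x0 \<longleftrightarrow> v x0 = u x0 \<and> (\<forall>\<^sub>F x in nhds x0. v x \<le> u x)"

definition viscosity_solution ::
  "(real^'n^'n \<Rightarrow> real) \<Rightarrow> (real^'n) set \<Rightarrow> (real^'n \<Rightarrow> real) \<Rightarrow> bool" where
  "viscosity_solution F D u \<longleftrightarrow> continuous_on D u \<and>
     (\<forall>x0\<in>D. \<forall>a b. \<forall>M\<in>sym_mats.
        (touches_above (paraboloid a b M) u x0 \<longrightarrow> F M \<ge> - pos_ind u x0) \<and>
        (touches_below (paraboloid a b M) u x0 \<longrightarrow> F M \<le> - pos_ind u x0))"

section \<open>Local Sobolev spaces\<close>

definition test_function :: "(real^'n) set \<Rightarrow> (real^'n \<Rightarrow> real) \<Rightarrow> bool" where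
  "test_function D \<phi> \<longleftrightarrow> smooth_on_subspace UNIV UNIV \<phi> \<and>
     compact (closure {x. \<phi> x \<noteq> 0}) \<and> closure {x. \<phi> x \<noteq> 0} \<subseteq> D"

text \<open>Multi-indices are lists of coordinate directions.\<close>

primrec iter_partial :: "'n list \<Rightarrow> (real^'n \<Rightarrow> real) \<Rightarrow> real^'n \<Rightarrow> real" where
  "iter_partial [] f = f"
| "iter_partial (i # is) f = (\<lambda>x. frechet_derivative (iter_partial is f) (at x) (axis i 1))"

definition Lp_loc :: "nat \<Rightarrow> (real^'n) set \<Rightarrow> (real^'n \<Rightarrow> real) \<Rightarrow> bool" where
  "Lp_loc p D f \<longleftrightarrow> f \<in> borel_measurable (lebesgue_on D) \<and>
     (\<forall>K. compact K \<and> K \<subseteq> D \<longrightarrow> integrable (lebesgue_on K) (\<lambda>x. \<bar>f x\<bar> ^ p))"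

definition weak_partial ::
  "(real^'n) set \<Rightarrow> 'n list \<Rightarrow> (real^'n \<Rightarrow> real) \<Rightarrow> (real^'n \<Rightarrow> real) \<Rightarrow> bool" where
  "weak_partial D is f g \<longleftrightarrow> (\<forall>\<phi>. test_function D \<phi> \<longrightarrow>
     (LINT x|lebesgue_on D. f x * iter_partial is \<phi> x)
       = (- 1) ^ length is * (LINT x|lebesgue_on D. g x * \<phi> x))"

definition W_loc :: "nat \<Rightarrow> nat \<Rightarrow> (real^'n) set \<Rightarrow> (real^'n \<Rightarrow> real) set" where
  "W_loc k p D = {f. Lp_loc p D f \<and>
     (\<forall>is. length is \<le> k \<longrightarrow> (\<exists>g. Lp_loc p D g \<and> weak_partial D is f g))}"

definition weak_hessian ::
  "(real^'n) set \<Rightarrow> (real^'n \<Rightarrow> real) \<Rightarrow> (real^'n \<Rightarrow> real^'n^'n) \<Rightarrow> bool" where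
  "weak_hessian D f H \<longleftrightarrow>
     (\<forall>i j. Lp_loc 1 D (\<lambda>x. H x $ i $ j) \<and> weak_partial D [i, j] f (\<lambda>x. H x $ i $ j))"

section \<open>Maximal solutions\<close>

text \<open>The weak Hessian is determined, and symmetric, up to a null set.\<close>

definition strong_subsolution ::
  "(real^'n^'n \<Rightarrow> real) \<Rightarrow> (real^'n) set \<Rightarrow> (real^'n \<Rightarrow> real) \<Rightarrow> bool" where
  "strong_subsolution F D v \<longleftrightarrow>
     v \<in> W_loc 2 CARD('n) D \<and> continuous_on (closure D) v \<and>
     (\<exists>H. weak_hessian D v H \<and>
        (AE x in lebesgue. x \<in> D \<longrightarrow> F (H x) \<ge> - pos_ind v x))"

text \<open>Competitors live on bounded subdomains whose closure lies in \<open>D\<close>: \<open>u\<close> is given on \<open>D\<close> only, so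
  the condition on the boundary needs \<open>closure D' \<subseteq> D\<close>, and without boundedness \<open>D' = D = UNIV\<close>, which
  has empty boundary, would exclude every \<open>u\<close>.\<close>

definition maximal_solution ::
  "(real^'n^'n \<Rightarrow> real) \<Rightarrow> (real^'n) set \<Rightarrow> (real^'n \<Rightarrow> real) \<Rightarrow> bool" where
  "maximal_solution F D u \<longleftrightarrow> viscosity_solution F D u \<and>
     (\<forall>D' v. domain D' \<and> bounded D' \<and> closure D' \<subseteq> D \<and> strong_subsolution F D' v \<and>
             (\<forall>x\<in>frontier D'. v x \<le> u x)
           \<longrightarrow> (\<forall>x\<in>D'. v x \<le> u x))"

text \<open>The constants \<open>\<lambda>, \<Lambda>\<close> enter bounds for solutions only through the scale-invariant number
  \<open>\<gamma> = \<Lambda> (n - 1) / \<lambda> - 1\<close> and an overall factor \<open>1 / \<Lambda>\<close>: if \<open>u\<close> is a (maximal) solution for \<open>F\<close>, then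
  \<open>u / K\<close> is one for \<open>K F\<close>, which has the constants \<open>K \<lambda>, K \<Lambda>\<close> and the same \<open>\<gamma>\<close>.\<close>

definition ellipticity_exponent :: "nat \<Rightarrow> real \<Rightarrow> real \<Rightarrow> real" where
  "ellipticity_exponent n l L = L * (real n - 1) / l - 1"

end

theory Submission
  imports Defs
begin

text \<open>A maximal solution lies above every strong subsolution that it dominates on the boundary of a ball,
  so a barrier that is negative on the sphere and positive at the centre suffices. A Gaussian
  \<open>v = K (exp (- a \<bar>x - x\<^sub>0\<bar>\<^sup>2) - exp (- \<Gamma> / 2))\<close> on the ball of radius \<open>\<rho>\<close> serves, with
  \<open>a = 2 \<Gamma> / \<rho>\<^sup>2\<close>: where \<open>v \<le> 0\<close>, that is \<open>2 a \<bar>x - x\<^sub>0\<bar>\<^sup>2 \<ge> \<Gamma>\<close>, the positive radial part of its Hessian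
  outweighs the negative part as soon as \<open>\<Gamma> \<ge> \<Lambda> / \<lambda>\<close>, and where \<open>v > 0\<close> the choice \<open>K = 1 / (2 a \<Lambda>)\<close> gives
  \<open>F (D\<^sup>2v) \<ge> -1\<close>. In contrast to a barrier glued from a paraboloid and a power of \<open>\<bar>x - x\<^sub>0\<bar>\<close>, this one is
  smooth, so integration by parts yields its weak derivatives.\<close>

section \<open>Integration by parts against compactly supported functions\<close>

lemma has_derivative_zero_outside_closed:
  fixes g :: "'a::real_normed_vector \<Rightarrow> real"
  assumes "(g has_derivative g') (at x)" "closed S" "\<And>y. y \<notin> S \<Longrightarrow> g y = 0" "x \<notin> S"
  shows "g' e = 0"
proof -
  have "((\<lambda>_. 0) has_derivative g') (at x)"
    using has_derivative_transform_within_open[OF assms(1), of "- S" "\<lambda>_. 0"] assms by auto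
  then have "g' = (\<lambda>_. 0)"
    using has_derivative_unique has_derivative_const by blast
  then show ?thesis by simp
qed

lemma integrable_continuous_compact_support:
  fixes f :: "'a::euclidean_space \<Rightarrow> real"
  assumes "continuous_on UNIV f" "compact S" "\<And>x. x \<notin> S \<Longrightarrow> f x = 0"
  shows "integrable lborel f"
proof -
  have "set_integrable lborel S f"
    using assms borel_integrable_compact[of S f] continuous_on_subset
    unfolding set_integrable_def by (metis subset_UNIV indicator_scaleR_eq_if)
  moreover have "(\<lambda>x. indicator S x *\<^sub>R f x) = f"
    using assms(3) by (fastforce simp: indicator_def)
  ultimately show ?thesis by (simp add: set_integrable_def)
qed

text \<open>Translation invariance makes the integrals of the difference quotients vanish; dominated
  convergence passes to the limit.\<close>

lemma integral_directional_derivative_eq_0: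
  fixes g :: "'a::euclidean_space \<Rightarrow> real"
  assumes der: "\<And>x. (g has_derivative g' x) (at x)"
    and cont: "continuous_on UNIV (\<lambda>x. g' x e)"
    and S: "compact S" "\<And>x. x \<notin> S \<Longrightarrow> g x = 0"
  shows "(LINT x|lborel. g' x e) = 0"
proof -
  have g'0: "g' x e = 0" if "x \<notin> S" for x
    using has_derivative_zero_outside_closed[OF der compact_imp_closed[OF S(1)]] S(2) that by blast
  have gcont: "continuous_on UNIV g"
    by (intro continuous_at_imp_continuous_on ballI has_derivative_continuous[OF der])
  have gint: "integrable lborel g"
    by (rule integrable_continuous_compact_support[OF gcont S])
  have "compact ((\<lambda>x. g' x e) ` S)"
    using S(1) cont compact_continuous_image continuous_on_subset by blast
  then obtain B0 where "\<forall>x\<in>S. \<bar>g' x e\<bar> \<le> B0"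
    by (auto dest!: compact_imp_bounded simp: bounded_iff)
  \<comment> \<open>The absolute value of \<open>B0\<close> covers an empty \<open>S\<close>, for
    which \<open>B0\<close> may be negative.\<close>
  then have B: "\<bar>g' x e\<bar> \<le> \<bar>B0\<bar>" for x
    using g'0[of x] by (cases "x \<in> S") fastforce+
  obtain R where R: "\<And>x. x \<in> S \<Longrightarrow> norm x \<le> R"
    using compact_imp_bounded[OF S(1)] by (auto simp: bounded_iff)
  define h where "h n = 1 / real (Suc n)" for n
  have h: "0 < h n" "h n \<le> 1" for n by (auto simp: h_def)
  define q where "q n x = (g (x + h n *\<^sub>R e) - g x) / h n" for n x
  have line: "((\<lambda>s. g (x + s *\<^sub>R e)) has_real_derivative g' (x + s *\<^sub>R e) e) (at s)" for x s
  proof -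
    have "((\<lambda>s. g (x + s *\<^sub>R e)) has_derivative (\<lambda>t. g' (x + s *\<^sub>R e) (t *\<^sub>R e))) (at s)"
      by (rule has_derivative_compose[OF _ der]) (auto intro!: derivative_eq_intros)
    moreover have "(\<lambda>t. g' (x + s *\<^sub>R e) (t *\<^sub>R e)) = (*) (g' (x + s *\<^sub>R e) e)"
      using has_derivative_linear[OF der] by (auto simp: linear_cmul)
    ultimately show ?thesis by (simp add: has_field_derivative_def)
  qed
  have qlim: "(\<lambda>n. q n x) \<longlonglongrightarrow> g' x e" for x
  proof -
    have "((\<lambda>s. (g (x + s *\<^sub>R e) - g x) / s) \<longlongrightarrow> g' x e) (at 0)"
      using line[of x 0] by (simp add: DERIV_def)
    moreover have "filterlim h (at 0) sequentially"
      unfolding filterlim_at using LIMSEQ_Suc[OF lim_1_over_n] h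
      by (auto simp: h_def[abs_def] less_imp_neq[symmetric])
    ultimately show ?thesis
      unfolding q_def by (rule filterlim_compose)
  qed
  have qbound: "\<bar>q n x\<bar> \<le> \<bar>B0\<bar>" for n x
  proof -
    \<comment> \<open>By the mean value theorem along the segment each difference quotient is a
      value of the derivative, so the bound is uniform in \<open>n\<close>.\<close>
    obtain z where "g (x + h n *\<^sub>R e) - g (x + 0 *\<^sub>R e) = (h n - 0) * g' (x + z *\<^sub>R e) e"
      using MVT2[of 0 "h n" "\<lambda>s. g (x + s *\<^sub>R e)" "\<lambda>s. g' (x + s *\<^sub>R e) e"] h(1) line by blast
    then have "q n x = g' (x + z *\<^sub>R e) e"
      using h(1)[of n] by (simp add: q_def)
    then show ?thesis using B by simp
  qed
  \<comment> \<open>The steps \<open>h n\<close> are at most 1, so all difference quotients vanish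
    off one fixed ball: the support has radius at most \<open>R\<close> and is shifted by at most
    \<open>norm e\<close>.\<close>
  let ?w = "\<lambda>x::'a. \<bar>B0\<bar> * indicator (cball 0 (R + norm e)) x :: real"
  have qw: "\<bar>q n x\<bar> \<le> ?w x" for n x
  proof (cases "norm x \<le> R + norm e")
    case True
    then show ?thesis using qbound by simp
  next
    case False
    have "norm (h n *\<^sub>R e) \<le> norm e"
      using h[of n] by (simp add: mult_left_le_one_le)
    moreover have "norm x \<le> norm (x + h n *\<^sub>R e) + norm (h n *\<^sub>R e)"
      by (metis add_diff_cancel_right' norm_triangle_ineq4)
    ultimately have "x \<notin> S" "x + h n *\<^sub>R e \<notin> S"
      using R[of x] R[of "x + h n *\<^sub>R e"] False norm_ge_zero[of e] by linarith+
    then show ?thesis using S(2) by (simp add: q_def)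
  qed
  have shift: "integrable lborel (\<lambda>x. g (x + c))" "(LINT x|lborel. g (x + c)) = (LINT x|lborel. g x)" for c
  proof -
    have m: "(+) c \<in> measurable lborel borel" "g \<in> borel_measurable borel"
      using gcont by (auto intro: borel_measurable_continuous_onI)
    show "integrable lborel (\<lambda>x. g (x + c))"
      using integrable_distr_eq[OF m] gint by (simp add: lborel_distr_plus add.commute)
    show "(LINT x|lborel. g (x + c)) = (LINT x|lborel. g x)"
      using integral_distr[OF m] by (simp add: lborel_distr_plus add.commute)
  qed
  have "(\<lambda>n. LINT x|lborel. q n x) \<longlonglongrightarrow> (LINT x|lborel. g' x e)"
  proof (rule integral_dominated_convergence[where w = ?w])
    show "(\<lambda>x. g' x e) \<in> borel_measurable lborel"
      using cont by (simp add: borel_measurable_continuous_onI)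
    show "q n \<in> borel_measurable lborel" for n
      unfolding q_def using shift(1) gint by (intro borel_measurable_integrable) auto
    have "emeasure lborel (cball (0::'a) (R + norm e)) < \<infinity>"
      by (rule emeasure_bounded_finite) auto
    then show "integrable lborel ?w"
      by (intro integrable_mult_right integrable_real_indicator) simp_all
  qed (use qlim qw in auto)
  moreover have "(LINT x|lborel. q n x) = 0" for n
    using shift gint by (simp add: q_def)
  ultimately show ?thesis
    by (simp add: LIMSEQ_const_iff)
qed

text \<open>The product \<open>f * g\<close> inherits the compact support of \<open>g\<close>, so
  the integral of its directional derivative is zero; the product rule splits this integral into the
  two terms.\<close>

lemma integral_by_parts_compact_support:
  fixes f g :: "'a::euclidean_space \<Rightarrow> real"
  assumes f: "\<And>x. (f has_derivative f' x) (at x)" "continuous_on UNIV (\<lambda>x. f' x e)"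
    and g: "\<And>x. (g has_derivative g' x) (at x)" "continuous_on UNIV (\<lambda>x. g' x e)"
    and S: "compact S" "\<And>x. x \<notin> S \<Longrightarrow> g x = 0" "S \<subseteq> D" and D: "D \<in> sets lebesgue"
  shows "(LINT x|lebesgue_on D. f x * g' x e) = - (LINT x|lebesgue_on D. f' x e * g x)"
proof -
  have g'0: "g' x e = 0" if "x \<notin> S" for x
    using has_derivative_zero_outside_closed[OF g(1) compact_imp_closed[OF S(1)]] S(2) that by blast
  have fc: "continuous_on UNIV f" and gc: "continuous_on UNIV g"
    by (intro continuous_at_imp_continuous_on ballI has_derivative_continuous[OF f(1)]
          has_derivative_continuous[OF g(1)])+
  have i1: "integrable lborel (\<lambda>x. f x * g' x e)"
    by (rule integrable_continuous_compact_support[OF _ S(1)])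
       (use g'0 fc g in \<open>auto intro!: continuous_intros\<close>)
  have i2: "integrable lborel (\<lambda>x. f' x e * g x)"
    by (rule integrable_continuous_compact_support[OF _ S(1)])
       (use S(2) gc f in \<open>auto intro!: continuous_intros\<close>)
  have "(LINT x|lborel. (f x * g' x e + f' x e * g x)) = 0"
    by (rule integral_directional_derivative_eq_0
          [where g = "\<lambda>x. f x * g x" and g' = "\<lambda>x e. f x * g' x e + f' x e * g x", OF _ _ S(1)])
       (use S(2) f g fc gc in \<open>auto intro!: continuous_intros has_derivative_mult\<close>)
  then have *: "(LINT x|lborel. f x * g' x e) = - (LINT x|lborel. f' x e * g x)"
    using i1 i2 by simp
  \<comment> \<open>Restriction to \<open>D\<close> costs nothing because \<open>S\<close> lies in
    \<open>D\<close>, and passing to the completed measure does not change the integral of a Borel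
    function.\<close>
  have on: "(LINT x|lebesgue_on D. k x) = (LINT x|lborel. k x)"
    if "integrable lborel k" "\<And>x. x \<notin> S \<Longrightarrow> k x = 0" for k :: "'a \<Rightarrow> real"
  proof -
    have "(\<lambda>x. indicator D x *\<^sub>R k x) = k"
      using that(2) S(3) by (fastforce simp: indicator_def)
    then have "(LINT x|lebesgue_on D. k x) = (LINT x|lebesgue. k x)"
      using D integral_restrict_space[of D lebesgue k] by simp
    also have "\<dots> = (LINT x|lborel. k x)"
      using that(1) by (intro integral_completion) auto
    finally show ?thesis .
  qed
  show ?thesis
    using on[OF i1] on[OF i2] g'0 S(2) * by auto
qed

section \<open>Weak derivatives of classical functions\<close>

lemma Lp_loc_continuous:
  fixes f :: "real^'n \<Rightarrow> real"
  assumes "continuous_on UNIV f" "open D"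
  shows "Lp_loc p D f"
  unfolding Lp_loc_def
proof (intro conjI allI impI)
  show "f \<in> borel_measurable (lebesgue_on D)"
    using assms by (intro continuous_imp_measurable_on_sets_lebesgue)
      (auto intro: continuous_on_subset)
  fix K :: "(real^'n) set" assume "compact K \<and> K \<subseteq> D"
  then have K: "compact K" "K \<in> sets lebesgue"
    using lmeasurable_compact by auto
  have "continuous_on K (\<lambda>x. \<bar>f x\<bar> ^ p)"
    using assms by (intro continuous_intros) (auto intro: continuous_on_subset)
  then have "integrable lborel (\<lambda>x. indicator K x *\<^sub>R (\<bar>f x\<bar> ^ p))"
    by (rule borel_integrable_compact[OF K(1)])
  then have "integrable lebesgue (\<lambda>x. indicator K x *\<^sub>R (\<bar>f x\<bar> ^ p))"
    by (intro integrable_completion[THEN iffD2]) auto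
  then show "integrable (lebesgue_on K) (\<lambda>x. \<bar>f x\<bar> ^ p)"
    using K(2) by (simp add: integrable_restrict_space)
qed

lemma outside_closure_support:
  fixes \<phi> :: "'a::topological_space \<Rightarrow> real"
  shows "x \<notin> closure {x. \<phi> x \<noteq> 0} \<Longrightarrow> \<phi> x = 0"
  using closure_subset[of "{x. \<phi> x \<noteq> 0}"] by blast

lemma test_function_has_derivative:
  fixes \<phi> :: "real^'n \<Rightarrow> real"
  assumes "test_function D \<phi>"
  shows "(\<phi> has_derivative frechet_derivative \<phi> (at x)) (at x)"
proof -
  have "Ck_on (Suc 0) UNIV UNIV \<phi>"
    using assms unfolding test_function_def smooth_on_subspace_def by blast
  then have "\<phi> differentiable (at x)"
    by (auto simp: differentiable_def)
  then show ?thesis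
    by (simp add: frechet_derivative_works)
qed

text \<open>Differentiation keeps smoothness and does not enlarge the support. This allows iterated
  partial derivatives to be treated as test functions themselves.\<close>

lemma test_function_partial:
  fixes \<phi> :: "real^'n \<Rightarrow> real"
  assumes "test_function D \<phi>"
  shows "test_function D (\<lambda>x. frechet_derivative \<phi> (at x) v)"
proof -
  let ?d = "\<lambda>x. frechet_derivative \<phi> (at x) v"
  have "Ck_on k UNIV UNIV ?d" for k
  proof -
    have "Ck_on (Suc k) UNIV UNIV \<phi>"
      using assms unfolding test_function_def smooth_on_subspace_def by blast
    then obtain f' where f': "\<And>x. (\<phi> has_derivative f' x) (at x)" "Ck_on k UNIV UNIV (\<lambda>x. f' x v)"
      by auto
    \<comment> \<open>Derivatives on the whole space are unique, so the witness hidden in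
      \<open>Ck_on\<close> is the Frechet derivative that \<open>iter_partial\<close> uses.\<close>
    have "f' = (\<lambda>x. frechet_derivative \<phi> (at x))"
      using f'(1) frechet_derivative_at by blast
    then show ?thesis using f'(2) by simp
  qed
  moreover have "{x. ?d x \<noteq> 0} \<subseteq> closure {x. \<phi> x \<noteq> 0}"
  proof clarify
    fix x assume nz: "?d x \<noteq> 0"
    show "x \<in> closure {x. \<phi> x \<noteq> 0}"
    proof (rule ccontr)
      assume "x \<notin> closure {x. \<phi> x \<noteq> 0}"
      then have "?d x = 0"
        using has_derivative_zero_outside_closed[OF test_function_has_derivative[OF assms] closed_closure]
          outside_closure_support[of _ \<phi>] by blast
      with nz show False ..
    qed
  qed
  then have "closure {x. ?d x \<noteq> 0} \<subseteq> closure {x. \<phi> x \<noteq> 0}"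
    by (simp add: closure_minimal)
  ultimately show ?thesis
    using assms compact_Int_closed[of "closure {x. \<phi> x \<noteq> 0}" "closure {x. ?d x \<noteq> 0}"]
    unfolding test_function_def smooth_on_subspace_def by (auto simp: Int_absorb1)
qed

lemma test_function_iter_partial:
  "test_function D \<phi> \<Longrightarrow> test_function D (iter_partial is \<phi>)"
  by (induction "is") (simp_all add: test_function_partial)

lemma weak_partial_Nil: "weak_partial D [] f f"
  by (simp add: weak_partial_def)

text \<open>The head \<open>i\<close> is the outermost derivative on the test function, so one
  integration by parts moves exactly this one to \<open>f\<close>, at the price of one sign; the
  tail is left to the weak derivative of the classical partial.\<close>

lemma weak_partial_Cons:
  fixes f :: "real^'n \<Rightarrow> real"
  assumes f: "\<And>x. (f has_derivative f' x) (at x)" "continuous_on UNIV (\<lambda>x. f' x (axis i 1))"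
    and "open D" and weak: "weak_partial D is (\<lambda>x. f' x (axis i 1)) g"
  shows "weak_partial D (i # is) f g"
  unfolding weak_partial_def
proof (intro allI impI)
  fix \<phi> :: "real^'n \<Rightarrow> real" assume \<phi>: "test_function D \<phi>"
  let ?\<psi> = "iter_partial is \<phi>"
  have \<psi>: "test_function D ?\<psi>"
    by (rule test_function_iter_partial[OF \<phi>])
  \<comment> \<open>The partial derivative is again a test function, hence differentiable, hence
    continuous.\<close>
  have "continuous_on UNIV (\<lambda>x. frechet_derivative ?\<psi> (at x) (axis i 1))"
    using test_function_has_derivative[OF test_function_partial[OF \<psi>]]
    by (intro continuous_at_imp_continuous_on ballI has_derivative_continuous)
  moreover have "compact (closure {x. ?\<psi> x \<noteq> 0})" "closure {x. ?\<psi> x \<noteq> 0} \<subseteq> D"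
    using \<psi> unfolding test_function_def by blast+
  moreover have "D \<in> sets lebesgue"
    using \<open>open D\<close> by simp
  ultimately have "(LINT x|lebesgue_on D. f x * frechet_derivative ?\<psi> (at x) (axis i 1))
      = - (LINT x|lebesgue_on D. f' x (axis i 1) * ?\<psi> x)"
    by (intro integral_by_parts_compact_support[OF f test_function_has_derivative[OF \<psi>],
          where S = "closure {x. ?\<psi> x \<noteq> 0}"] outside_closure_support)
  then show "(LINT x|lebesgue_on D. f x * iter_partial (i # is) \<phi> x)
      = (- 1) ^ length (i # is) * (LINT x|lebesgue_on D. g x * \<phi> x)"
    using weak \<phi> by (simp add: weak_partial_def)
qed

lemma weak_partial_gradient:
  fixes f :: "real^'n \<Rightarrow> real"
  assumes "\<And>x. (f has_derivative (\<lambda>h. G x \<bullet> h)) (at x)" "continuous_on UNIV (\<lambda>x. G x $ i)" "open D"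
  shows "weak_partial D [i] f (\<lambda>x. G x $ i)"
  using assms weak_partial_Nil by (intro weak_partial_Cons[OF assms(1)]) (auto simp: inner_axis)

text \<open>\<open>G\<close> is the gradient and row \<open>i\<close> of \<open>H\<close> the
  gradient of its \<open>i\<close>-th component, so two integrations by parts identify
  \<open>H\<close> as the weak Hessian; continuity gives all local integrability. With data on the
  whole space, continuity up to the boundary of \<open>D\<close> is immediate.\<close>

lemma strong_subsolution_C2:
  fixes f :: "real^'n \<Rightarrow> real"
  assumes f: "\<And>x. (f has_derivative (\<lambda>h. G x \<bullet> h)) (at x)"
    and G: "\<And>x i. ((\<lambda>x. G x $ i) has_derivative (\<lambda>h. H x $ i \<bullet> h)) (at x)"
    and H: "continuous_on UNIV H" and D: "open D"
    and sub: "\<And>x. x \<in> D \<Longrightarrow> F (H x) \<ge> - pos_ind f x"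
  shows "strong_subsolution F D f"
proof -
  have fc: "continuous_on UNIV f"
    by (intro continuous_at_imp_continuous_on ballI has_derivative_continuous[OF f])
  have Gc: "continuous_on UNIV (\<lambda>x. G x $ i)" for i
    by (intro continuous_at_imp_continuous_on ballI has_derivative_continuous[OF G])
  have Hc: "continuous_on UNIV (\<lambda>x. H x $ i $ j)" for i j
    using H by (intro continuous_intros)
  have w1: "weak_partial D [i] f (\<lambda>x. G x $ i)" for i
    by (rule weak_partial_gradient[OF f Gc D])
  have w2: "weak_partial D [i, j] f (\<lambda>x. H x $ i $ j)" for i j
  proof (rule weak_partial_Cons[OF f])
    show "weak_partial D [j] (\<lambda>x. G x \<bullet> axis i 1) (\<lambda>x. H x $ i $ j)"
      using weak_partial_gradient[OF G Hc D] by (simp add: inner_axis)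
  qed (use Gc D in \<open>auto simp: inner_axis\<close>)
  have "\<exists>g. Lp_loc CARD('n) D g \<and> weak_partial D is f g" if len: "length is \<le> 2" for "is"
  proof -
    consider "is = []" | i where "is = [i]" | i j where "is = [i, j]"
      using len by (auto simp: numeral_2_eq_2 le_Suc_eq length_Suc_conv)
    then show ?thesis
      using w1 w2 weak_partial_Nil Lp_loc_continuous[OF fc D] Lp_loc_continuous[OF Gc D]
        Lp_loc_continuous[OF Hc D] by cases blast+
  qed
  then have "f \<in> W_loc 2 CARD('n) D"
    using Lp_loc_continuous[OF fc D] by (simp add: W_loc_def)
  moreover have "weak_hessian D f H"
    using w2 Lp_loc_continuous[OF Hc D] by (simp add: weak_hessian_def)
  ultimately show ?thesis
    unfolding strong_subsolution_def using sub fc continuous_on_subset by blast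
qed

section \<open>Ellipticity bounds for a rank-one matrix minus a multiple of the identity\<close>

text \<open>The matrix with rows \<open>x $ i *\<^sub>R x\<close> is the rank-one product of the
  column \<open>x\<close> with its transpose.\<close>

lemma outer_mult_vec: "(\<chi> i. x $ i *\<^sub>R x) *v y = (x \<bullet> y) *\<^sub>R (x::real^'n)"
  by (simp add: vec_eq_iff matrix_mult_dot mult.commute)

lemma mat_norm_ge: "norm (M *v x) \<le> mat_norm M * norm x"
  unfolding mat_norm_def by (intro onorm matrix_vector_mul_bounded_linear)

lemma mat_norm_nonneg: "0 \<le> mat_norm M"
  unfolding mat_norm_def by (intro onorm_pos_le matrix_vector_mul_bounded_linear)

text \<open>The vector \<open>x\<close> is an eigenvector with eigenvalue
  \<open>\<alpha> * (x \<bullet> x)\<close>; testing the operator norm on it suffices.\<close>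

lemma mat_norm_outer_ge:
  fixes x :: "real^'n"
  assumes "\<alpha> \<ge> 0"
  shows "\<alpha> * (x \<bullet> x) \<le> mat_norm (\<alpha> *\<^sub>R (\<chi> i. x $ i *\<^sub>R x))"
proof (cases "x = 0")
  case True
  then show ?thesis by (simp add: mat_norm_nonneg)
next
  case False
  have "norm ((\<alpha> *\<^sub>R (\<chi> i. x $ i *\<^sub>R x)) *v x) = \<alpha> * (x \<bullet> x) * norm x"
    using assms by (simp add: scaleR_matrix_vector_assoc[symmetric] outer_mult_vec)
  then show ?thesis
    using mat_norm_ge[of "\<alpha> *\<^sub>R (\<chi> i. x $ i *\<^sub>R x)" x] False by simp
qed

text \<open>Ellipticity between the zero matrix and the identity, whose operator norm is 1.\<close>

lemma elliptic_at_identity: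
  assumes "uniformly_elliptic l L (F :: real^'n^'n \<Rightarrow> real)" "F 0 = 0"
  shows "0 \<le> F (mat 1)" "F (mat 1) \<le> L"
proof -
  have "transpose (mat 1 :: real^'n^'n) = mat 1"
    by (rule transpose_mat)
  then have "(mat 1 :: real^'n^'n) \<in> sym_mats" "(0 :: real^'n^'n) \<in> sym_mats" "nonneg_mat (mat 1 :: real^'n^'n)"
    by (simp_all add: sym_mats_def nonneg_mat_def transpose_def zero_vec_def)
  then have *: "l * mat_norm (mat 1 :: real^'n^'n) \<le> F (mat 1)" "F (mat 1) \<le> L * mat_norm (mat 1 :: real^'n^'n)"
    and pos: "0 < l" "0 < L"
    using assms unfolding uniformly_elliptic_def by fastforce+
  have "(*v) (mat 1 :: real^'n^'n) = (\<lambda>x. x)"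
    by (simp add: fun_eq_iff)
  then have "mat_norm (mat 1 :: real^'n^'n) = 1"
    unfolding mat_norm_def using onorm_id[where 'a = "real^'n"] by simp
  with * pos show "0 \<le> F (mat 1)" "F (mat 1) \<le> L"
    by auto
qed

text \<open>Adding the nonnegative rank-one matrix to \<open>- \<beta>\<close> times the identity
  gains at least \<open>l\<close> times its norm. The starting value is
  \<open>- \<beta> * F (mat 1)\<close>, by homogeneity with a negative factor.\<close>

lemma elliptic_outer_minus_identity:
  fixes x :: "real^'n"
  assumes ell: "uniformly_elliptic l L F" and hom: "smooth_homogeneous F"
    and "\<alpha> \<ge> 0" "\<beta> \<ge> 0"
  shows "F (\<alpha> *\<^sub>R (\<chi> i. x $ i *\<^sub>R x) - \<beta> *\<^sub>R mat 1) \<ge> l * \<alpha> * (x \<bullet> x) - L * \<beta>"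
proof -
  let ?N = "\<alpha> *\<^sub>R (\<chi> i. x $ i *\<^sub>R x)" and ?M = "(- \<beta>) *\<^sub>R mat 1 :: real^'n^'n"
  have I: "(mat 1 :: real^'n^'n) \<in> sym_mats"
    by (simp add: sym_mats_def)
  have sym: "?M \<in> sym_mats" "?N \<in> sym_mats"
    by (auto simp: sym_mats_def transpose_def vec_eq_iff mat_def mult.commute)
  have nonneg: "nonneg_mat ?N"
    using \<open>\<alpha> \<ge> 0\<close> by (simp add: nonneg_mat_def scaleR_matrix_vector_assoc[symmetric] outer_mult_vec
        inner_commute[of _ x] mult.assoc)
  have l: "l > 0"
    using ell by (simp add: uniformly_elliptic_def)
  have "l * (\<alpha> * (x \<bullet> x)) \<le> l * mat_norm ?N"
    using mat_norm_outer_ge[OF \<open>\<alpha> \<ge> 0\<close>] l by (intro mult_left_mono) auto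
  also have "\<dots> \<le> F (?M + ?N) - F ?M"
    using ell sym nonneg unfolding uniformly_elliptic_def by blast
  finally have "l * \<alpha> * (x \<bullet> x) \<le> F (?M + ?N) - F ?M"
    by (simp add: mult.assoc)
  moreover have "F ?M = - \<beta> * F (mat 1)"
    using hom I unfolding smooth_homogeneous_def by blast
  moreover have "\<beta> * F (mat 1) \<le> L * \<beta>"
    using elliptic_at_identity[OF ell] hom \<open>\<beta> \<ge> 0\<close>
    by (simp add: smooth_homogeneous_def mult.commute[of L] mult_left_mono)
  ultimately show ?thesis
    by (simp add: algebra_simps)
qed

text \<open>In dimension one \<open>\<gamma> = -1\<close> carries no information on \<open>\<Lambda> / \<lambda>\<close>, so the previous bound is not good
  enough there.\<close>

lemma elliptic_outer_minus_identity_dim1: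
  fixes x :: "real^'n"
  assumes ell: "uniformly_elliptic l L F" and hom: "smooth_homogeneous F"
    and "CARD('n) = 1" "\<beta> \<le> \<alpha> * (x \<bullet> x)"
  shows "F (\<alpha> *\<^sub>R (\<chi> i. x $ i *\<^sub>R x) - \<beta> *\<^sub>R mat 1) \<ge> 0"
proof -
  obtain a :: 'n where a: "UNIV = {a}"
    using assms(3) card_1_singletonE by blast
  then have all: "(\<forall>i. P i) \<longleftrightarrow> P a" for P
    by (metis UNIV_I singletonD)
  have "x \<bullet> x = x $ a * x $ a"
    by (simp add: inner_vec_def a)
  \<comment> \<open>Here every matrix is a multiple of the identity, so homogeneity and
    \<open>F (mat 1) \<ge> 0\<close> decide the sign, whatever the ratio of the ellipticity
    constants.\<close>
  then have "\<alpha> *\<^sub>R (\<chi> i. x $ i *\<^sub>R x) - \<beta> *\<^sub>R mat 1 = (\<alpha> * (x \<bullet> x) - \<beta>) *\<^sub>R (mat 1 :: real^'n^'n)"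
    by (simp add: vec_eq_iff mat_def all)
  moreover have "F ((\<alpha> * (x \<bullet> x) - \<beta>) *\<^sub>R mat 1) = (\<alpha> * (x \<bullet> x) - \<beta>) * F (mat 1)"
    using hom unfolding smooth_homogeneous_def by (simp add: sym_mats_def)
  ultimately show ?thesis
    using elliptic_at_identity(1)[OF ell] hom assms(4) by (simp add: smooth_homogeneous_def)
qed

section \<open>The Gaussian barrier\<close>

text \<open>This is \<Gamma> of the overview. It exceeds \<gamma> + 1 = \<Lambda> (n - 1) /
  \<lambda>, which is at least \<Lambda> / \<lambda> for n \<ge> 2; the bound by 2 serves dimension
  one and keeps the rate positive for every real \<gamma>.\<close>

definition gaussian_rate :: "real \<Rightarrow> real" where
  "gaussian_rate \<gamma> = \<bar>\<gamma>\<bar> + 2"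

text \<open>The depth of the barrier on the boundary sphere after the factor \<rho>^2 / \<Lambda> is
  taken out: there the Gaussian equals exp (- 2 \<Gamma>), and K = \<rho>^2 / (4 \<Gamma>
  \<Lambda>).\<close>

definition barrier_depth :: "real \<Rightarrow> real" where
  "barrier_depth \<gamma> =
     (exp (- gaussian_rate \<gamma> / 2) - exp (- 2 * gaussian_rate \<gamma>)) / (4 * gaussian_rate \<gamma>)"

lemma gaussian_rate_ge: "gaussian_rate \<gamma> \<ge> 2" "gaussian_rate \<gamma> \<ge> \<gamma> + 1"
  by (auto simp: gaussian_rate_def)

lemma barrier_depth_pos: "barrier_depth \<gamma> > 0"
  using gaussian_rate_ge(1)[of \<gamma>] by (simp add: barrier_depth_def)

lemma exists_barrier:
  fixes F :: "real^'n^'n \<Rightarrow> real"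
  assumes ell: "uniformly_elliptic l L F" and hom: "smooth_homogeneous F" and "\<rho> > 0"
  obtains v where "strong_subsolution F (ball x0 \<rho>) v" "v x0 > 0"
    "\<And>x. x \<in> sphere x0 \<rho> \<Longrightarrow>
       v x = - (barrier_depth (ellipticity_exponent CARD('n) l L) / L * \<rho>\<^sup>2)"
proof -
  let ?\<gamma> = "ellipticity_exponent CARD('n) l L"
  define \<Gamma> where "\<Gamma> = gaussian_rate ?\<gamma>"
  \<comment> \<open>This rate puts the zero set of \<open>v\<close> on the sphere of radius \<rho> /
    2 and makes \<open>v\<close> negative on the sphere of radius \<rho>.\<close>
  define a where "a = 2 * \<Gamma> / \<rho>\<^sup>2"
  define K where "K = 1 / (2 * a * L)"
  define e where "e x = exp (- a * ((x - x0) \<bullet> (x - x0)))" for x :: "real^'n"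
  define v where "v x = K * (e x - exp (- \<Gamma> / 2))" for x
  \<comment> \<open>\<open>G\<close> and \<open>H\<close> are the gradient and the Hessian of
    \<open>v\<close>; \<open>H\<close> has the form rank-one matrix minus multiple of the
    identity.\<close>
  define G where "G x = (- (2 * a * K * e x)) *\<^sub>R (x - x0)" for x
  define H where "H x = (4 * a\<^sup>2 * K * e x) *\<^sub>R (\<chi> i. (x - x0) $ i *\<^sub>R (x - x0))
    - (2 * a * K * e x) *\<^sub>R (mat 1 :: real^'n^'n)" for x
  have lL: "l > 0" "L > 0"
    using ell by (auto simp: uniformly_elliptic_def)
  have \<Gamma>: "\<Gamma> \<ge> 2" "\<Gamma> \<ge> ?\<gamma> + 1"
    by (simp_all add: \<Gamma>_def gaussian_rate_ge)
  have a: "a > 0" and K: "K > 0"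
    using \<Gamma> lL \<open>\<rho> > 0\<close> by (auto simp: a_def K_def)
  have e: "0 < e x" "e x \<le> 1" for x
    using a by (auto simp: e_def)
  have der_e: "(e has_derivative (\<lambda>h. - (2 * a * e x * ((x - x0) \<bullet> h)))) (at x)" for x
    unfolding e_def
    by (rule derivative_eq_intros refl)+ (auto simp: fun_eq_iff inner_commute algebra_simps)
  have der_v: "(v has_derivative (\<lambda>h. G x \<bullet> h)) (at x)" for x
    unfolding v_def by (rule derivative_eq_intros der_e refl)+ (auto simp: G_def fun_eq_iff)
  have der_nth: "((\<lambda>x. (x - x0) $ i) has_derivative (\<lambda>h. h $ i)) (at x)" for x i
    by (auto intro!: derivative_eq_intros bounded_linear_imp_has_derivative bounded_linear_vec_nth)
  have der_G: "((\<lambda>x. G x $ i) has_derivative (\<lambda>h. H x $ i \<bullet> h)) (at x)" for x i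
  proof -
    have "((\<lambda>x. - (2 * a * K) * (e x * (x - x0) $ i)) has_derivative
        (\<lambda>h. - (2 * a * K) * (e x * h $ i + - (2 * a * e x * ((x - x0) \<bullet> h)) * (x - x0) $ i))) (at x)"
      by (intro has_derivative_mult_right has_derivative_mult der_e der_nth)
    moreover have "mat 1 $ i \<bullet> h = h $ i" for h :: "real^'n"
      by (simp add: inner_vec_def mat_def if_distrib[of "\<lambda>t. t * _"] cong: if_cong)
    ultimately show ?thesis
      by (simp add: G_def H_def inner_diff_left power2_eq_square algebra_simps)
  qed
  have "continuous_on UNIV H"
  proof -
    have "continuous_on UNIV e"
      by (intro continuous_at_imp_continuous_on ballI has_derivative_continuous[OF der_e])
    then show ?thesis
      unfolding H_def by (intro continuous_intros)
  qed
  moreover have "F (H x) \<ge> - pos_ind v x" for x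
  proof (cases "v x > 0")
    case True
    have "- 1 \<le> - e x"
      using e by simp
    also have "\<dots> = - (L * (2 * a * K * e x))"
      using a lL by (simp add: K_def)
    \<comment> \<open>The radial part is nonnegative and can only help.\<close>
    also have "\<dots> \<le> l * (4 * a\<^sup>2 * K * e x) * ((x - x0) \<bullet> (x - x0)) - L * (2 * a * K * e x)"
      using K lL e(1)[of x] by simp
    also have "\<dots> \<le> F (H x)"
      unfolding H_def using a K e(1)[of x] by (intro elliptic_outer_minus_identity[OF ell hom]) auto
    finally show ?thesis
      using True by (simp add: pos_ind_def)
  next
    case False
    define t where "t = (x - x0) \<bullet> (x - x0)"
    have "e x \<le> exp (- \<Gamma> / 2)"
      using False K by (auto simp: v_def zero_less_mult_iff)
    then have at: "\<Gamma> \<le> 2 * a * t"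
      by (simp add: e_def t_def)
    \<comment> \<open>Where \<open>v\<close> is not positive the indicator vanishes, so the
      subsolution inequality demands the bound 0 instead of -1.\<close>
    have "F (H x) \<ge> 0"
    proof (cases "CARD('n) = 1")
      case True
      have "1 \<le> 2 * a * t"
        using at \<Gamma> by linarith
      then have "2 * a * K * e x * 1 \<le> 2 * a * K * e x * (2 * a * t)"
        using a K e(1)[of x] by (intro mult_left_mono) auto
      then show ?thesis
        unfolding H_def
        by (intro elliptic_outer_minus_identity_dim1[OF ell hom True])
           (simp add: t_def power2_eq_square algebra_simps)
    next
      case False
      \<comment> \<open>From n - 1 \<ge> 1 it follows that \<gamma> + 1 dominates \<Lambda> /
        \<lambda>; this is how \<gamma> alone controls the ellipticity ratio.\<close>
      then have "real CARD('n) - 1 \<ge> 1"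
        using zero_less_card_finite[where 'a = 'n] by linarith
      then have "L / l * 1 \<le> L / l * (real CARD('n) - 1)"
        using lL by (intro mult_left_mono) auto
      then have "L / l \<le> 2 * a * t"
        using \<Gamma>(2) at by (simp add: ellipticity_exponent_def)
      then have "L \<le> l * (2 * a * t)"
        using lL by (simp add: field_simps)
      then have "2 * a * K * e x * L \<le> 2 * a * K * e x * (l * (2 * a * t))"
        using a K e(1)[of x] by (intro mult_left_mono) auto
      then have "0 \<le> l * (4 * a\<^sup>2 * K * e x) * t - L * (2 * a * K * e x)"
        by (simp add: power2_eq_square algebra_simps)
      also have "\<dots> \<le> F (H x)"
        unfolding H_def t_def using a K e(1)[of x]
        by (intro elliptic_outer_minus_identity[OF ell hom]) auto
      finally show ?thesis .
    qed
    then show ?thesis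
      using False by (simp add: pos_ind_def)
  qed
  ultimately have "strong_subsolution F (ball x0 \<rho>) v"
    by (intro strong_subsolution_C2[OF der_v der_G]) auto
  moreover have "v x0 > 0"
    using K \<Gamma> by (simp add: v_def e_def)
  moreover have "v x = - (barrier_depth ?\<gamma> / L * \<rho>\<^sup>2)" if "x \<in> sphere x0 \<rho>" for x
  proof -
    have "(x - x0) \<bullet> (x - x0) = \<rho>\<^sup>2"
      using that by (simp add: dist_norm norm_minus_commute flip: power2_norm_eq_inner)
    then have "e x = exp (- 2 * \<Gamma>)"
      using \<open>\<rho> > 0\<close> by (simp add: e_def a_def)
    moreover have "K = \<rho>\<^sup>2 / (4 * \<Gamma> * L)"
      by (simp add: K_def a_def)
    ultimately show ?thesis
      using \<Gamma>(1) lL by (simp add: v_def barrier_depth_def flip: \<Gamma>_def) (simp add: field_simps)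
  qed
  ultimately show thesis
    using that by blast
qed

section \<open>Comparison of the maximal solution with the barrier\<close>

text \<open>The infimum is taken in \<open>ereal\<close>, so that a \<open>u\<close> unbounded below
  on the ball has infimum minus infinity and fails the hypothesis.\<close>

theorem theorem3p4:
  shows "\<exists>c :: real \<Rightarrow> real. (\<forall>\<gamma>. c \<gamma> > 0) \<and>
    (\<forall>(F :: real^'n^'n \<Rightarrow> real) l L D u.
       uniformly_elliptic l L F \<and> smooth_homogeneous F \<and> domain D \<and> maximal_solution F D u \<longrightarrow>
       (\<forall>x0 r. r > 0 \<and> ball x0 r \<subseteq> D \<longrightarrow>
          (INF x\<in>ball x0 r. ereal (u x))
            > ereal (- (c (ellipticity_exponent CARD('n) l L) / L * r\<^sup>2)) \<longrightarrow>
          u x0 > 0))"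
proof (intro exI[of _ barrier_depth] conjI allI impI)
  show "barrier_depth \<gamma> > 0" for \<gamma>
    by (rule barrier_depth_pos)
next
  fix F :: "real^'n^'n \<Rightarrow> real" and l L D u x0 r
  define C where "C = barrier_depth (ellipticity_exponent CARD('n) l L) / L"
  assume asm: "uniformly_elliptic l L F \<and> smooth_homogeneous F \<and> domain D \<and> maximal_solution F D u"
    and r: "r > 0 \<and> ball x0 r \<subseteq> D"
    and inf: "(INF x\<in>ball x0 r. ereal (u x))
      > ereal (- (barrier_depth (ellipticity_exponent CARD('n) l L) / L * r\<^sup>2))"
  \<comment> \<open>The level \<open>m\<close> strictly between the two sides leaves room to shrink
    the radius.\<close>
  obtain m where m: "- (C * r\<^sup>2) < m" "ereal m < (INF x\<in>ball x0 r. ereal (u x))"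
    using ereal_dense2[OF inf] by (auto simp: C_def)
  \<comment> \<open>Competitors need a ball whose closure lies in \<open>D\<close>, but only the
    open ball of radius \<open>r\<close> is known to lie there. By continuity a slightly smaller
    radius keeps the boundary value of the barrier below \<open>m\<close>.\<close>
  have "((\<lambda>\<rho>. - (C * \<rho>\<^sup>2)) \<longlongrightarrow> - (C * r\<^sup>2)) (at_left r)"
    by (intro tendsto_intros)
  then have "\<forall>\<^sub>F \<rho> in at_left r. - (C * \<rho>\<^sup>2) < m"
    using m(1) by (rule order_tendstoD)
  moreover have "\<forall>\<^sub>F \<rho> in at_left r. \<rho> \<in> {0<..<r}"
    using r by (intro eventually_at_left_real) auto
  ultimately obtain \<rho> where \<rho>: "- (C * \<rho>\<^sup>2) < m" "0 < \<rho>" "\<rho> < r"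
    using eventually_happens[OF eventually_conj] trivial_limit_at_left_real by fastforce
  obtain v where v: "strong_subsolution F (ball x0 \<rho>) v" "v x0 > 0"
    "\<And>x. x \<in> sphere x0 \<rho> \<Longrightarrow> v x = - (C * \<rho>\<^sup>2)"
    using exists_barrier[of l L F \<rho> x0] asm \<rho>(2) unfolding C_def by blast
  \<comment> \<open>The sphere of radius \<rho> lies inside the open ball of radius
    \<open>r\<close>, where \<open>u\<close> exceeds \<open>m\<close>.\<close>
  have "v x \<le> u x" if "x \<in> frontier (ball x0 \<rho>)" for x
  proof -
    have x: "x \<in> sphere x0 \<rho>"
      using that \<rho>(2) by simp
    then have "ereal m < ereal (u x)"
      using m(2) \<rho>(3) by (intro less_le_trans[OF m(2) INF_lower]) simp
    then show ?thesis
      using v(3)[OF x] \<rho>(1) by simp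
  qed
  moreover have "closure (ball x0 \<rho>) \<subseteq> D"
    using r \<rho> by (auto simp: subset_iff)
  moreover have "domain (ball x0 \<rho>)"
    using \<rho>(2) by (simp add: domain_def)
  ultimately have "\<forall>x\<in>ball x0 \<rho>. v x \<le> u x"
    using asm v(1) bounded_ball unfolding maximal_solution_def by blast
  then show "u x0 > 0"
    using v(2) \<rho>(2) by (meson centre_in_ball less_le_trans)
qed

end
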